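(* Let $P,PA$ be labelings, $c$ any command, and $\rho_1,\rho_2,\mu_1,\mu_2$ states. Assume $\mathtt b\notin\mathrm{UsedVars}(c)$, $\rho_1(\mathtt b)=\rho_2(\mathtt b)=0$, $|a|_{\mu_1}>0$ and $|a|_{\mu_2}>0$ for every array $a$, $\rho_1\sim_P\rho_2$, $\mu_1\sim_{PA}\mu_2$, and $\langle c,\rho_1,\mu_1\rangle\approx\langle c,\rho_2,\mu_2\rangle$. Let $(\hat c,P',PA')=\mathcal F(c,P,PA,\mathtt{true})$. Then $\langle T(\hat c),\rho_1,\mu_1,\mathtt{false}\rangle\approx_s\langle T(\hat c),\rho_2,\mu_2,\mathtt{false}\rangle$.
   Context: Language AWhile: scalar variables $X\in\mathcal V$, arrays $a\in\mathcal A$; $e::=n\mid X\mid\mathrm{op}_{\mathbb N}(e,\dots,e)\mid be\,?\,e_1:e_2$; $be::=\mathtt{true}\mid\mathtt{false}\mid\mathrm{cmp}(e,e)\mid\mathrm{op}_{\mathbb B}(be,\dots,be)$; $c::=\mathtt{skip}\mid X:=e\mid c_1;c_2\mid\mathtt{if}\ be\ \mathtt{then}\ c_1\ \mathtt{else}\ c_2\mid\mathtt{while}\ be\ \mathtt{do}\ c\mid X\leftarrow a[e]\mid a[e]\leftarrow e'$. Scalar state $\rho:\mathcal V\to\mathbb N$; array state $\mu$ with sizes $|a|_\mu$ and values $\mu(a)[i]$; $[\![\cdot]\!]_\rho$ pure evaluation. $\mathrm{UsedVars}(c)$: scalar variables occurring in $c$; $\mathtt b$ a reserved scalar variable. Sequential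 semantics: $X:=e\to\mathtt{skip}$ updating $X$; $c_1;c_2\xrightarrow{o}c_1';c_2$ if $c_1\xrightarrow{o}c_1'$; $\mathtt{skip};c\to c$; conditional goes to branch $v=[\![be]\!]_\rho$ observing $\mathrm{branch}(v)$; $\mathtt{while}\ be\ \mathtt{do}\ c\to\mathtt{if}\ be\ \mathtt{then}\ (c;\mathtt{while}\ be\ \mathtt{do}\ c)\ \mathtt{else}\ \mathtt{skip}$; $X\leftarrow a[ie]$ with $i=[\![ie]\!]_\rho<|a|_\mu$ sets $X:=\mu(a)[i]$ observing $\mathrm{read}(a,i)$; $a[ie]\leftarrow e$ with $i<|a|_\mu$ sets $\mu[a[i]\mapsto[\![e]\!]_\rho]$ observing $\mathrm{write}(a,i)$. $\langle c_1,\rho_1,\mu_1\rangle\approx\langle c_2,\rho_2,\mu_2\rangle$ iff for all multi-step executions $\langle c_k,\rho_k,\mu_k\rangle\xrightarrow{O_k}{}^*$ (any prefix), one of $O_1,O_2$ is a prefix of the other. Speculative semantics: configurations $\langle c,\rho,\mu,\beta\rangle$; non-observing rules as sequentially (flag kept, no directive). Conditional: with directive $\mathit{step}$ as sequentially; with $\mathit{force}$ go to branch $\neg[\![be]\!]_\rho$ and set $\beta:=\mathtt{true}$; obs $\mathrm{branch}([\![be]\!]_\rho)$. Reads/writes with $\mathit{step}$ as sequentially. Read with $\mathrm{load}(a',j)$: requires $\beta=\mathtt{true}$, $i=[\![ie]\!]_\rho\ge|a|_\mu$, $j<|a'|_\mu$, sets $X:=\mu(a')[j]$, obs $\mathrm{read}(a,i)$.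 Write with $\mathrm{store}(a',j)$: requires $\beta=\mathtt{true}$, $i\ge|a|_\mu$, $j<|a'|_\mu$, sets $\mu[a'[j]\mapsto[\![e]\!]_\rho]$, obs $\mathrm{write}(a,i)$. $\langle c_1,\rho_1,\mu_1,\beta_1\rangle\approx_s\langle c_2,\rho_2,\mu_2,\beta_2\rangle$ iff for all $D,O_1,O_2$, whenever both multi-step with the same directive list $D$ producing $O_1,O_2$, $O_1=O_2$. Labels: $\mathtt{true}$=public, $\mathtt{false}$=secret; $\ell_1\sqsubseteq\ell_2$ iff $\ell_2=\mathtt{true}\Rightarrow\ell_1=\mathtt{true}$; $\ell_1\sqcup\ell_2=\ell_1\wedge\ell_2$, lifted pointwise to labelings. $P(e),P(be)$ public iff all variables occurring are public. $\rho_1\sim_P\rho_2$: agreement on public scalar variables; $\mu_1\sim_{PA}\mu_2$: agreement on sizes and contents of public arrays. Annotated commands: $\hat c::=\mathtt{skip}\mid X:=e\mid \hat c_1;_{P,PA}\hat c_2\mid\mathtt{if}_\ell\ be\ \mathtt{then}\ \hat c_1\ \mathtt{else}\ \hat c_2\mid\mathtt{while}_{\ell,P,PA}\ be\ \mathtt{do}\ \hat c\mid X\leftarrow_{\ell_X,\ell_i}a[e]\mid a[e]\leftarrow_{\ell_i}e'$. Flow-sensitive IFC analysis $\mathcal F(c,P,PA,pc)=(\hat c,P',PA')$: $\mathtt{skip}\mapsto(\mathtt{skip},P,PA)$; $X:=e\mapsto(X:=e,P[X\mapsto P(e)],PA)$; $c_1;c_2\mapsto(\hat c_1;_{P_1,PA_1}\hat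 c_2,P_2,PA_2)$ where $(\hat c_1,P_1,PA_1)=\mathcal F(c_1,P,PA,pc)$, $(\hat c_2,P_2,PA_2)=\mathcal F(c_2,P_1,PA_1,pc)$; $\mathtt{if}\ be\ \mathtt{then}\ c_1\ \mathtt{else}\ c_2\mapsto(\mathtt{if}_{P(be)}\ be\ \mathtt{then}\ \hat c_1\ \mathtt{else}\ \hat c_2,P_1\sqcup P_2,PA_1\sqcup PA_2)$ where $(\hat c_k,P_k,PA_k)=\mathcal F(c_k,P,PA,pc\sqcup P(be))$; $\mathtt{while}\ be\ \mathtt{do}\ c\mapsto(\mathtt{while}_{P_f(be),P_f,PA_f}\ be\ \mathtt{do}\ \hat c,P_f,PA_f)$ where $\hat c$ is the first component of $\mathcal F(c,P_f,PA_f,pc\sqcup P_f(be))$ and $(P_f,PA_f)$ is a fixpoint of $G(P'',PA'')=(P''',PA''')\sqcup(P,PA)$, with $(\_,P''',PA''')=\mathcal F(c,P'',PA'',pc\sqcup P''(be))$, obtained by iterating $G$ from $(P,PA)$ (bounded by the number of variables and arrays assigned in $c$); $X\leftarrow a[i]\mapsto(X\leftarrow_{\ell,P(i)}a[i],P[X\mapsto\ell],PA)$ with $\ell=pc\sqcup P(i)\sqcup PA(a)$; $a[i]\leftarrow e\mapsto(a[i]\leftarrow_{P(i)}e,P,PA[a\mapsto PA(a)\sqcup pc\sqcup P(i)\sqcup P(e)])$. Translation $T$ (FS-FvSLH) of annotated commands: with $m(i)=(\mathtt b==1)\,?\,0:i$ and $B_\ell(be)=be$ if $\ell=\mathtt{true}$,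 $B_\ell(be)=(\mathtt b==0\ \&\&\ be)$ if $\ell=\mathtt{false}$: $\mathtt{skip}$, $X:=e$ unchanged; $\hat c_1;_{P,PA}\hat c_2\mapsto T(\hat c_1);T(\hat c_2)$; $\mathtt{if}_\ell\ be\ \mathtt{then}\ \hat c_1\ \mathtt{else}\ \hat c_2\mapsto\mathtt{if}\ B_\ell(be)\ \mathtt{then}\ (\mathtt b:=B_\ell(be)\,?\,\mathtt b:1;T(\hat c_1))\ \mathtt{else}\ (\mathtt b:=B_\ell(be)\,?\,1:\mathtt b;T(\hat c_2))$; $\mathtt{while}_{\ell,P,PA}\ be\ \mathtt{do}\ \hat c\mapsto(\mathtt{while}\ B_\ell(be)\ \mathtt{do}\ (\mathtt b:=B_\ell(be)\,?\,\mathtt b:1;T(\hat c)));\ \mathtt b:=B_\ell(be)\,?\,1:\mathtt b$; $X\leftarrow_{\ell_X,\ell_i}a[i]\mapsto(X\leftarrow a[i];X:=(\mathtt b==1)\,?\,0:X)$ if $\ell_X=\ell_i=\mathtt{true}$, $X\leftarrow a[i]$ if $\ell_X=\mathtt{false},\ell_i=\mathtt{true}$, and $X\leftarrow a[m(i)]$ if $\ell_i=\mathtt{false}$; $a[i]\leftarrow_{\ell_i}e\mapsto a[i]\leftarrow e$ if $\ell_i=\mathtt{true}$ and $a[m(i)]\leftarrow e$ if $\ell_i=\mathtt{false}$. *)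

theory Defs
  imports Main "HOL-Library.Sublist"
begin

type_synonym vname = string
type_synonym aname = string

datatype aexp =
    ANum nat
  | AVar vname
  | AOp "nat list \<Rightarrow> nat" "aexp list"
  | ACond bexp aexp aexp
and bexp =
    BTrue
  | BFalse
  | BCmp "nat \<Rightarrow> nat \<Rightarrow> bool" aexp aexp
  | BOp "bool list \<Rightarrow> bool" "bexp list"

datatype com =
    Skip
  | Asgn vname aexp
  | Seq com com
  | If bexp com com
  | While bexp com
  | ARead vname aname aexp
  | AWrite aname aexp aexp          (* a[e] <- e' *)

type_synonym state = "vname \<Rightarrow> nat"
type_synonym mem = "aname \<Rightarrow> nat list"

fun aval :: "aexp \<Rightarrow> state \<Rightarrow> nat" and bval :: "bexp \<Rightarrow> state \<Rightarrow> bool" where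
  "aval (ANum n) \<rho> = n"
| "aval (AVar x) \<rho> = \<rho> x"
| "aval (AOp f es) \<rho> = f (map (\<lambda>e. aval e \<rho>) es)"
| "aval (ACond be e1 e2) \<rho> = (if bval be \<rho> then aval e1 \<rho> else aval e2 \<rho>)"
| "bval BTrue \<rho> = True"
| "bval BFalse \<rho> = False"
| "bval (BCmp f e1 e2) \<rho> = f (aval e1 \<rho>) (aval e2 \<rho>)"
| "bval (BOp f bs) \<rho> = f (map (\<lambda>b. bval b \<rho>) bs)"

fun avars :: "aexp \<Rightarrow> vname set" and bvars :: "bexp \<Rightarrow> vname set" where
  "avars (ANum n) = {}"
| "avars (AVar x) = {x}"
| "avars (AOp f es) = (\<Union>e\<in>set es. avars e)"
| "avars (ACond be e1 e2) = bvars be \<union> avars e1 \<union> avars e2"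
| "bvars BTrue = {}"
| "bvars BFalse = {}"
| "bvars (BCmp f e1 e2) = avars e1 \<union> avars e2"
| "bvars (BOp f bs) = (\<Union>b\<in>set bs. bvars b)"

primrec used_vars :: "com \<Rightarrow> vname set" where
  "used_vars Skip = {}"
| "used_vars (Asgn X e) = {X} \<union> avars e"
| "used_vars (Seq c1 c2) = used_vars c1 \<union> used_vars c2"
| "used_vars (If be c1 c2) = bvars be \<union> used_vars c1 \<union> used_vars c2"
| "used_vars (While be c) = bvars be \<union> used_vars c"
| "used_vars (ARead X a i) = {X} \<union> avars i"
| "used_vars (AWrite a i e) = avars i \<union> avars e"

definition bvar :: vname where "bvar = ''b''"

datatype obs = OBranch bool | ORead aname nat | OWrite aname nat

datatype dir = DStep | DForce | DLoad aname nat | DStore aname nat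

text \<open>Small step; the observation list has length at most one.\<close>
inductive seq_step :: "com \<Rightarrow> state \<Rightarrow> mem \<Rightarrow> obs list \<Rightarrow> com \<Rightarrow> state \<Rightarrow> mem \<Rightarrow> bool" where
  Seq_Asgn: "seq_step (Asgn X e) \<rho> \<mu> [] Skip (\<rho>(X := aval e \<rho>)) \<mu>"
| Seq_Seq: "seq_step c1 \<rho> \<mu> os c1' \<rho>' \<mu>' \<Longrightarrow> seq_step (Seq c1 c2) \<rho> \<mu> os (Seq c1' c2) \<rho>' \<mu>'"
| Seq_Skip: "seq_step (Seq Skip c) \<rho> \<mu> [] c \<rho> \<mu>"
| Seq_If: "seq_step (If be c1 c2) \<rho> \<mu> [OBranch (bval be \<rho>)]
             (if bval be \<rho> then c1 else c2) \<rho> \<mu>"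
| Seq_While: "seq_step (While be c) \<rho> \<mu> [] (If be (Seq c (While be c)) Skip) \<rho> \<mu>"
| Seq_Read: "\<lbrakk> i = aval ie \<rho>; i < length (\<mu> a) \<rbrakk> \<Longrightarrow>
             seq_step (ARead X a ie) \<rho> \<mu> [ORead a i] Skip (\<rho>(X := \<mu> a ! i)) \<mu>"
| Seq_Write: "\<lbrakk> i = aval ie \<rho>; i < length (\<mu> a) \<rbrakk> \<Longrightarrow>
             seq_step (AWrite a ie e) \<rho> \<mu> [OWrite a i] Skip \<rho> (\<mu>(a := (\<mu> a)[i := aval e \<rho>]))"

inductive seq_steps :: "com \<Rightarrow> state \<Rightarrow> mem \<Rightarrow> obs list \<Rightarrow> com \<Rightarrow> state \<Rightarrow> mem \<Rightarrow> bool" where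
  Seqs_refl: "seq_steps c \<rho> \<mu> [] c \<rho> \<mu>"
| Seqs_step: "\<lbrakk> seq_step c \<rho> \<mu> os1 c' \<rho>' \<mu>'; seq_steps c' \<rho>' \<mu>' os2 c'' \<rho>'' \<mu>'' \<rbrakk> \<Longrightarrow>
              seq_steps c \<rho> \<mu> (os1 @ os2) c'' \<rho>'' \<mu>''"

definition seq_obs_equiv :: "com \<Rightarrow> state \<Rightarrow> mem \<Rightarrow> com \<Rightarrow> state \<Rightarrow> mem \<Rightarrow> bool" where
  "seq_obs_equiv c1 \<rho>1 \<mu>1 c2 \<rho>2 \<mu>2 \<longleftrightarrow>
     (\<forall>O1 O2 c1' \<rho>1' \<mu>1' c2' \<rho>2' \<mu>2'.
        seq_steps c1 \<rho>1 \<mu>1 O1 c1' \<rho>1' \<mu>1' \<longrightarrow> seq_steps c2 \<rho>2 \<mu>2 O2 c2' \<rho>2' \<mu>2' \<longrightarrow>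
        prefix O1 O2 \<or> prefix O2 O1)"

text \<open>Small step; directive and observation lists have length at most one.\<close>
inductive spec_step :: "com \<Rightarrow> state \<Rightarrow> mem \<Rightarrow> bool \<Rightarrow> dir list \<Rightarrow> obs list \<Rightarrow>
                        com \<Rightarrow> state \<Rightarrow> mem \<Rightarrow> bool \<Rightarrow> bool" where
  Spec_Asgn: "spec_step (Asgn X e) \<rho> \<mu> \<beta> [] [] Skip (\<rho>(X := aval e \<rho>)) \<mu> \<beta>"
| Spec_Seq: "spec_step c1 \<rho> \<mu> \<beta> ds os c1' \<rho>' \<mu>' \<beta>' \<Longrightarrow>
             spec_step (Seq c1 c2) \<rho> \<mu> \<beta> ds os (Seq c1' c2) \<rho>' \<mu>' \<beta>'"
| Spec_Skip: "spec_step (Seq Skip c) \<rho> \<mu> \<beta> [] [] c \<rho> \<mu> \<beta>"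
| Spec_If: "spec_step (If be c1 c2) \<rho> \<mu> \<beta> [DStep] [OBranch (bval be \<rho>)]
              (if bval be \<rho> then c1 else c2) \<rho> \<mu> \<beta>"
| Spec_If_F: "spec_step (If be c1 c2) \<rho> \<mu> \<beta> [DForce] [OBranch (bval be \<rho>)]
              (if \<not> bval be \<rho> then c1 else c2) \<rho> \<mu> True"
| Spec_While: "spec_step (While be c) \<rho> \<mu> \<beta> [] [] (If be (Seq c (While be c)) Skip) \<rho> \<mu> \<beta>"
| Spec_Read: "\<lbrakk> i = aval ie \<rho>; i < length (\<mu> a) \<rbrakk> \<Longrightarrow>
              spec_step (ARead X a ie) \<rho> \<mu> \<beta> [DStep] [ORead a i] Skip (\<rho>(X := \<mu> a ! i)) \<mu> \<beta>"
| Spec_Read_U: "\<lbrakk> \<beta> = True; i = aval ie \<rho>; i \<ge> length (\<mu> a); j < length (\<mu> a') \<rbrakk> \<Longrightarrow>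
              spec_step (ARead X a ie) \<rho> \<mu> \<beta> [DLoad a' j] [ORead a i] Skip (\<rho>(X := \<mu> a' ! j)) \<mu> \<beta>"
| Spec_Write: "\<lbrakk> i = aval ie \<rho>; i < length (\<mu> a) \<rbrakk> \<Longrightarrow>
              spec_step (AWrite a ie e) \<rho> \<mu> \<beta> [DStep] [OWrite a i] Skip \<rho>
                 (\<mu>(a := (\<mu> a)[i := aval e \<rho>])) \<beta>"
| Spec_Write_U: "\<lbrakk> \<beta> = True; i = aval ie \<rho>; i \<ge> length (\<mu> a); j < length (\<mu> a') \<rbrakk> \<Longrightarrow>
              spec_step (AWrite a ie e) \<rho> \<mu> \<beta> [DStore a' j] [OWrite a i] Skip \<rho>
                 (\<mu>(a' := (\<mu> a')[j := aval e \<rho>])) \<beta>"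

inductive spec_steps :: "com \<Rightarrow> state \<Rightarrow> mem \<Rightarrow> bool \<Rightarrow> dir list \<Rightarrow> obs list \<Rightarrow>
                         com \<Rightarrow> state \<Rightarrow> mem \<Rightarrow> bool \<Rightarrow> bool" where
  Specs_refl: "spec_steps c \<rho> \<mu> \<beta> [] [] c \<rho> \<mu> \<beta>"
| Specs_step: "\<lbrakk> spec_step c \<rho> \<mu> \<beta> ds1 os1 c' \<rho>' \<mu>' \<beta>';
                 spec_steps c' \<rho>' \<mu>' \<beta>' ds2 os2 c'' \<rho>'' \<mu>'' \<beta>'' \<rbrakk> \<Longrightarrow>
               spec_steps c \<rho> \<mu> \<beta> (ds1 @ ds2) (os1 @ os2) c'' \<rho>'' \<mu>'' \<beta>''"

definition spec_obs_equiv :: "com \<Rightarrow> state \<Rightarrow> mem \<Rightarrow> bool \<Rightarrow> com \<Rightarrow> state \<Rightarrow> mem \<Rightarrow> bool \<Rightarrow> bool" where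
  "spec_obs_equiv c1 \<rho>1 \<mu>1 \<beta>1 c2 \<rho>2 \<mu>2 \<beta>2 \<longleftrightarrow>
     (\<forall>D O1 O2 c1' \<rho>1' \<mu>1' \<beta>1' c2' \<rho>2' \<mu>2' \<beta>2'.
        spec_steps c1 \<rho>1 \<mu>1 \<beta>1 D O1 c1' \<rho>1' \<mu>1' \<beta>1' \<longrightarrow>
        spec_steps c2 \<rho>2 \<mu>2 \<beta>2 D O2 c2' \<rho>2' \<mu>2' \<beta>2' \<longrightarrow> O1 = O2)"

text \<open>True = public, False = secret; join is conjunction.\<close>
type_synonym label = bool
type_synonym plab = "vname \<Rightarrow> label"
type_synonym palab = "aname \<Rightarrow> label"

definition join_lab :: "('a \<Rightarrow> label) \<Rightarrow> ('a \<Rightarrow> label) \<Rightarrow> ('a \<Rightarrow> label)" where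
  "join_lab L1 L2 = (\<lambda>x. L1 x \<and> L2 x)"

definition lab_a :: "plab \<Rightarrow> aexp \<Rightarrow> label" where
  "lab_a P e \<longleftrightarrow> (\<forall>x\<in>avars e. P x)"

definition lab_b :: "plab \<Rightarrow> bexp \<Rightarrow> label" where
  "lab_b P be \<longleftrightarrow> (\<forall>x\<in>bvars be. P x)"

text \<open>Low-equivalence (for scalar states: agreement on public variables;
  for array states: agreement (sizes and contents) on public arrays).\<close>
definition pub_equiv :: "('a \<Rightarrow> label) \<Rightarrow> ('a \<Rightarrow> 'b) \<Rightarrow> ('a \<Rightarrow> 'b) \<Rightarrow> bool" where
  "pub_equiv L s1 s2 \<longleftrightarrow> (\<forall>x. L x \<longrightarrow> s1 x = s2 x)"

datatype acom =
    AC_Skip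
  | AC_Asgn vname aexp
  | AC_Seq acom plab palab acom
  | AC_If label bexp acom acom
  | AC_While label plab palab bexp acom
  | AC_Read vname label label aname aexp     (* X <-_{lX, li} a[e] *)
  | AC_Write aname label aexp aexp           (* a[e] <-_{li} e' *)

primrec assigned_vars :: "com \<Rightarrow> vname set" where
  "assigned_vars Skip = {}"
| "assigned_vars (Asgn X e) = {X}"
| "assigned_vars (Seq c1 c2) = assigned_vars c1 \<union> assigned_vars c2"
| "assigned_vars (If be c1 c2) = assigned_vars c1 \<union> assigned_vars c2"
| "assigned_vars (While be c) = assigned_vars c"
| "assigned_vars (ARead X a i) = {X}"
| "assigned_vars (AWrite a i e) = {}"

primrec assigned_arrs :: "com \<Rightarrow> aname set" where
  "assigned_arrs Skip = {}"
| "assigned_arrs (Asgn X e) = {}"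
| "assigned_arrs (Seq c1 c2) = assigned_arrs c1 \<union> assigned_arrs c2"
| "assigned_arrs (If be c1 c2) = assigned_arrs c1 \<union> assigned_arrs c2"
| "assigned_arrs (While be c) = assigned_arrs c"
| "assigned_arrs (ARead X a i) = {}"
| "assigned_arrs (AWrite a i e) = {a}"

primrec ifc :: "com \<Rightarrow> plab \<Rightarrow> palab \<Rightarrow> label \<Rightarrow> acom \<times> plab \<times> palab" where
  "ifc Skip P PA pc = (AC_Skip, P, PA)"
| "ifc (Asgn X e) P PA pc = (AC_Asgn X e, P(X := lab_a P e), PA)"
| "ifc (Seq c1 c2) P PA pc =
     (case ifc c1 P PA pc of (h1, P1, PA1) \<Rightarrow>
        case ifc c2 P1 PA1 pc of (h2, P2, PA2) \<Rightarrow> (AC_Seq h1 P1 PA1 h2, P2, PA2))"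
| "ifc (If be c1 c2) P PA pc =
     (case ifc c1 P PA (pc \<and> lab_b P be) of (h1, P1, PA1) \<Rightarrow>
        case ifc c2 P PA (pc \<and> lab_b P be) of (h2, P2, PA2) \<Rightarrow>
          (AC_If (lab_b P be) be h1 h2, join_lab P1 P2, join_lab PA1 PA2))"
| "ifc (While be c) P PA pc =
     (let G = (\<lambda>(Q, QA). case ifc c Q QA (pc \<and> lab_b Q be) of (_, Q', QA') \<Rightarrow>
                              (join_lab Q' P, join_lab QA' PA));
          n = card (assigned_vars c) + card (assigned_arrs c);
          (Pf, PAf) = (G ^^ n) (P, PA)
      in (AC_While (lab_b Pf be) Pf PAf be (fst (ifc c Pf PAf (pc \<and> lab_b Pf be))), Pf, PAf))"
| "ifc (ARead X a i) P PA pc =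
     (let l = (pc \<and> lab_a P i \<and> PA a) in (AC_Read X l (lab_a P i) a i, P(X := l), PA))"
| "ifc (AWrite a i e) P PA pc =
     (AC_Write a (lab_a P i) i e, P, PA(a := (PA a \<and> pc \<and> lab_a P i \<and> lab_a P e)))"

definition beq :: "aexp \<Rightarrow> aexp \<Rightarrow> bexp" where "beq e1 e2 = BCmp (=) e1 e2"
definition band :: "bexp \<Rightarrow> bexp \<Rightarrow> bexp" where "band b1 b2 = BOp (\<lambda>bs. bs ! 0 \<and> bs ! 1) [b1, b2]"

definition mask_idx :: "aexp \<Rightarrow> aexp" where
  "mask_idx i = ACond (beq (AVar bvar) (ANum 1)) (ANum 0) i"

definition Bl :: "label \<Rightarrow> bexp \<Rightarrow> bexp" where
  "Bl l be = (if l then be else band (beq (AVar bvar) (ANum 0)) be)"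

primrec fsfvslh :: "acom \<Rightarrow> com" where
  "fsfvslh AC_Skip = Skip"
| "fsfvslh (AC_Asgn X e) = Asgn X e"
| "fsfvslh (AC_Seq h1 P PA h2) = Seq (fsfvslh h1) (fsfvslh h2)"
| "fsfvslh (AC_If l be h1 h2) =
     If (Bl l be)
        (Seq (Asgn bvar (ACond (Bl l be) (AVar bvar) (ANum 1))) (fsfvslh h1))
        (Seq (Asgn bvar (ACond (Bl l be) (ANum 1) (AVar bvar))) (fsfvslh h2))"
| "fsfvslh (AC_While l P PA be h) =
     Seq (While (Bl l be) (Seq (Asgn bvar (ACond (Bl l be) (AVar bvar) (ANum 1))) (fsfvslh h)))
         (Asgn bvar (ACond (Bl l be) (ANum 1) (AVar bvar)))"
| "fsfvslh (AC_Read X lX li a i) =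
     (if li then
        (if lX then Seq (ARead X a i) (Asgn X (ACond (beq (AVar bvar) (ANum 1)) (ANum 0) (AVar X)))
         else ARead X a i)
      else ARead X a (mask_idx i))"
| "fsfvslh (AC_Write a li i e) = (if li then AWrite a i e else AWrite a (mask_idx i) e)"

end

theory Submission
  imports Defs "HOL-Library.Product_Order"
begin

text \<open>Two runs of the translated command under the same directives stay in lockstep at the same
  program point, by two different arguments. As long as no branch has been forced, the flag is 0,
  the translation simulates the source step by step, and equality of secret branch conditions and
  secret indices is exactly the observational equivalence of the source runs. Once a branch has
  been forced, the flag is 1, secret conditions evaluate to false and secret indices to 0, and the
  static labels alone make the remaining observations agree: every public value loaded from memory
  is masked, so only the labels of scalars have to stay sound. Reaching a fixpoint within the
  iteration bound uses that the analysis is monotone, so each iteration that changes the labels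
  turns at least one assigned variable or array secret.\<close>

section \<open>The order on labelings and evaluation in low-equivalent states\<close>

text \<open>In the boolean order secret (\<open>False\<close>) lies below public
  (\<open>True\<close>), so the join of the security lattice is the boolean infimum. Throughout,
  \<open>P' \<le> P\<close> means that \<open>P'\<close> declares no more public than
  \<open>P\<close>.\<close>

lemma join_lab_inf: "join_lab = inf"
  by (simp add: join_lab_def fun_eq_iff)

lemma lab_b_mono: "P \<le> Q \<Longrightarrow> lab_b P be \<Longrightarrow> lab_b Q be"
  by (auto simp: lab_b_def le_fun_def)

lemma pub_equiv_mono: "pub_equiv P s1 s2 \<Longrightarrow> Q \<le> P \<Longrightarrow> pub_equiv Q s1 s2"
  by (auto simp: pub_equiv_def le_fun_def)

lemma aval_bval_cong:
  "(\<forall>x\<in>avars e. \<rho> x = \<rho>' x) \<Longrightarrow> aval e \<rho> = aval e \<rho>'"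
  "(\<forall>x\<in>bvars be. \<rho> x = \<rho>' x) \<Longrightarrow> bval be \<rho> = bval be \<rho>'"
proof (induction e and be rule: avars_bvars.induct)
  case (3 f es)
  then have "map (\<lambda>e. aval e \<rho>) es = map (\<lambda>e. aval e \<rho>') es" by auto
  then show ?case by (simp only: aval.simps)
next
  case (8 f bs)
  then have "map (\<lambda>b. bval b \<rho>) bs = map (\<lambda>b. bval b \<rho>') bs" by auto
  then show ?case by (simp only: bval.simps)
qed auto

lemma aval_pub_equiv: "pub_equiv P \<rho> \<rho>' \<Longrightarrow> lab_a P e \<Longrightarrow> aval e \<rho> = aval e \<rho>'"
  by (rule aval_bval_cong) (auto simp: pub_equiv_def lab_a_def)

lemma bval_pub_equiv: "pub_equiv P \<rho> \<rho>' \<Longrightarrow> lab_b P be \<Longrightarrow> bval be \<rho> = bval be \<rho>'"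
  by (rule aval_bval_cong) (auto simp: pub_equiv_def lab_b_def)

section \<open>The analysis of loops\<close>

text \<open>This is the operator iterated by the analysis of a loop, with \<open>S\<close> the
  labels on entry and \<open>T\<close> the current iterate. Pairing the two labelings makes the
  product order and its lattice lemmas available.\<close>

definition loop_lab :: "bexp \<Rightarrow> com \<Rightarrow> label \<Rightarrow> plab \<times> palab \<Rightarrow> plab \<times> palab \<Rightarrow> plab \<times> palab" where
  "loop_lab be c pc S T = inf (snd (ifc c (fst T) (snd T) (pc \<and> lab_b (fst T) be))) S"

definition loop_bound :: "com \<Rightarrow> nat" where
  "loop_bound c = card (assigned_vars c) + card (assigned_arrs c)"

lemma ifc_While:
  "ifc (While be c) P PA pc =
     (case (loop_lab be c pc (P, PA) ^^ loop_bound c) (P, PA) of (Q, QA) \<Rightarrow>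
        (AC_While (lab_b Q be) Q QA be (fst (ifc c Q QA (pc \<and> lab_b Q be))), Q, QA))"
proof -
  have "(\<lambda>(Q, QA). case ifc c Q QA (pc \<and> lab_b Q be) of (_, Q', QA') \<Rightarrow>
            (join_lab Q' P, join_lab QA' PA)) = loop_lab be c pc (P, PA)"
    by (auto simp: fun_eq_iff loop_lab_def join_lab_inf inf_prod_def split: prod.splits)
  then show ?thesis
    by (simp add: loop_bound_def Let_def split: prod.splits)
qed

declare ifc.simps(5) [simp del]

lemma snd_ifc_Seq:
  "snd (ifc (Seq c1 c2) P PA pc) =
     snd (ifc c2 (fst (snd (ifc c1 P PA pc))) (snd (snd (ifc c1 P PA pc))) pc)"
  by (simp split: prod.splits)

lemma snd_ifc_While:
  "snd (ifc (While be c) P PA pc) = (loop_lab be c pc (P, PA) ^^ loop_bound c) (P, PA)"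
  by (simp add: ifc_While split: prod.splits)

lemma ifc_mono:
  "P \<le> Q \<Longrightarrow> PA \<le> QA \<Longrightarrow> pc \<le> pc' \<Longrightarrow> snd (ifc c P PA pc) \<le> snd (ifc c Q QA pc')"
proof (induction c arbitrary: P PA pc Q QA pc')
  case (Asgn X e)
  then show ?case by (auto simp: less_eq_prod_def le_fun_def lab_a_def)
next
  case (Seq c1 c2)
  from Seq.IH(1)[OF Seq.prems] show ?case
    unfolding snd_ifc_Seq by (intro Seq.IH(2) Seq.prems) (simp_all add: less_eq_prod_def)
next
  case (If be c1 c2)
  have "(pc \<and> lab_b P be) \<le> (pc' \<and> lab_b Q be)"
    using If.prems lab_b_mono by auto
  from If.IH(1)[OF If.prems(1,2) this] If.IH(2)[OF If.prems(1,2) this]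
  show ?case
    by (auto split: prod.splits simp: less_eq_prod_def join_lab_inf intro: le_infI1 le_infI2)
next
  case (While be c)
  let ?f = "loop_lab be c pc (P, PA)" and ?g = "loop_lab be c pc' (Q, QA)"
  have step: "?f S \<le> ?g T" if "S \<le> T" for S T
    unfolding loop_lab_def
    using that While.prems
    by (intro inf_mono While.IH) (auto simp: less_eq_prod_def dest: lab_b_mono)
  \<comment> \<open>Both analyses iterate equally often, because \<open>loop_bound c\<close> does
    not depend on the labels.\<close>
  have "(?f ^^ n) (P, PA) \<le> (?g ^^ n) (Q, QA)" for n
    using While.prems by (induction n) (simp_all add: step)
  then show ?case by (simp add: snd_ifc_While)
next
  case (ARead X a i)
  then show ?case by (auto simp: less_eq_prod_def le_fun_def Let_def lab_a_def)
next
  case (AWrite a i e)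
  then show ?case by (auto simp: less_eq_prod_def le_fun_def lab_a_def)
qed (auto simp: less_eq_prod_def)

text \<open>This confines all changes of the labels to a finite set, so that progress of the
  iteration can be counted although labelings are functions on infinitely many names.\<close>

lemma ifc_unassigned:
  "(\<forall>x. x \<notin> assigned_vars c \<longrightarrow> fst (snd (ifc c P PA pc)) x = P x) \<and>
   (\<forall>a. a \<notin> assigned_arrs c \<longrightarrow> snd (snd (ifc c P PA pc)) a = PA a)"
proof (induction c arbitrary: P PA pc)
  case (Seq c1 c2)
  show ?case
    using Seq.IH(1)[of P PA pc] Seq.IH(2)[of "fst (snd (ifc c1 P PA pc))" "snd (snd (ifc c1 P PA pc))" pc]
    by (auto split: prod.splits)
next
  case (If be c1 c2)
  show ?case
    using If.IH(1)[of P PA "pc \<and> lab_b P be"] If.IH(2)[of P PA "pc \<and> lab_b P be"]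
    by (auto split: prod.splits simp: join_lab_def)
next
  case (While be c)
  let ?f = "loop_lab be c pc (P, PA)"
  have "(\<forall>x. x \<notin> assigned_vars c \<longrightarrow> fst ((?f ^^ n) (P, PA)) x = P x) \<and>
        (\<forall>a. a \<notin> assigned_arrs c \<longrightarrow> snd ((?f ^^ n) (P, PA)) a = PA a)" for n
    by (induction n) (auto simp: loop_lab_def inf_prod_def While.IH)
  then show ?case by (simp add: snd_ifc_While)
qed (auto simp: Let_def)

lemma finite_assigned_vars: "finite (assigned_vars c)"
  by (induction c) auto

lemma finite_assigned_arrs: "finite (assigned_arrs c)"
  by (induction c) auto

text \<open>Each application that is not yet at a fixpoint lowers the measure by at least one. If
  \<open>n\<close> applications all did so, the measure would have reached 0 and could not drop
  again.\<close>

lemma funpow_reaches_fixpoint: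
  fixes m :: "'a \<Rightarrow> nat"
  assumes decr: "\<And>k. f ((f ^^ k) x) \<noteq> (f ^^ k) x \<Longrightarrow> m (f ((f ^^ k) x)) < m ((f ^^ k) x)"
    and "m x \<le> n"
  shows "f ((f ^^ n) x) = (f ^^ n) x"
proof -
  have "f ((f ^^ k) x) = (f ^^ k) x \<or> m ((f ^^ k) x) + k \<le> m x" for k
  proof (induction k)
    case (Suc k)
    then show ?case using decr[of k] by (cases "f ((f ^^ k) x) = (f ^^ k) x") auto
  qed simp
  from this[of n] show ?thesis using decr[of n] \<open>m x \<le> n\<close> by fastforce
qed

lemma loop_lab_fixpoint:
  "loop_lab be c pc (P, PA) ((loop_lab be c pc (P, PA) ^^ loop_bound c) (P, PA)) =
   (loop_lab be c pc (P, PA) ^^ loop_bound c) (P, PA)"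
proof -
  let ?A = "assigned_vars c" and ?B = "assigned_arrs c"
  let ?f = "loop_lab be c pc (P, PA)"
  \<comment> \<open>The measure counts the assigned variables and arrays that are still public;
    \<open>loop_bound c\<close> is its largest possible value.\<close>
  define m where "m S = card {x \<in> ?A. fst S x} + card {a \<in> ?B. snd S a}" for S :: "plab \<times> palab"
  have mono: "mono ?f"
    unfolding loop_lab_def
    by (intro monoI inf_mono ifc_mono) (auto simp: less_eq_prod_def dest: lab_b_mono)
  \<comment> \<open>The first iterate lies below the start because \<open>loop_lab\<close> takes the
    infimum with it; monotonicity carries this along the iteration.\<close>
  have decr: "?f ((?f ^^ k) (P, PA)) \<le> (?f ^^ k) (P, PA)" for k
  proof (induction k)
    case 0
    show ?case by (simp add: loop_lab_def)
  next
    case (Suc k)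
    then show ?case using monoD[OF mono] by simp
  qed
  have unassigned: "(\<forall>x. x \<notin> ?A \<longrightarrow> fst ((?f ^^ k) (P, PA)) x = P x) \<and>
        (\<forall>a. a \<notin> ?B \<longrightarrow> snd ((?f ^^ k) (P, PA)) a = PA a)" for k
    by (induction k) (auto simp: loop_lab_def inf_prod_def ifc_unassigned)
  have strict: "m T < m S"
    if "T \<le> S" "T \<noteq> S" "\<forall>x. x \<notin> ?A \<longrightarrow> fst T x = fst S x" "\<forall>a. a \<notin> ?B \<longrightarrow> snd T a = snd S a" for S T
  proof -
    have sub: "{x \<in> ?A. fst T x} \<subseteq> {x \<in> ?A. fst S x}" "{a \<in> ?B. snd T a} \<subseteq> {a \<in> ?B. snd S a}"
      using that(1) by (auto simp: less_eq_prod_def le_fun_def)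
    have fin: "finite {x \<in> ?A. fst S x}" "finite {a \<in> ?B. snd S a}"
      by (simp_all add: finite_assigned_vars finite_assigned_arrs)
    have "{x \<in> ?A. fst T x} \<noteq> {x \<in> ?A. fst S x} \<or> {a \<in> ?B. snd T a} \<noteq> {a \<in> ?B. snd S a}"
    proof (rule ccontr)
      assume "\<not> ?thesis"
      then have "fst T = fst S" "snd T = snd S"
        using that(3,4) by (auto simp: fun_eq_iff set_eq_iff)
      then show False using that(2) by (simp add: prod_eq_iff)
    qed
    then show ?thesis
    proof
      assume "{x \<in> ?A. fst T x} \<noteq> {x \<in> ?A. fst S x}"
      with sub(1) have "card {x \<in> ?A. fst T x} < card {x \<in> ?A. fst S x}"
        by (intro psubset_card_mono[OF fin(1)]) (rule psubsetI)
      with card_mono[OF fin(2) sub(2)] show ?thesis unfolding m_def by linarith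
    next
      assume "{a \<in> ?B. snd T a} \<noteq> {a \<in> ?B. snd S a}"
      with sub(2) have "card {a \<in> ?B. snd T a} < card {a \<in> ?B. snd S a}"
        by (intro psubset_card_mono[OF fin(2)]) (rule psubsetI)
      with card_mono[OF fin(1) sub(1)] show ?thesis unfolding m_def by linarith
    qed
  qed
  show ?thesis
  proof (rule funpow_reaches_fixpoint[where m = m])
    fix k assume "?f ((?f ^^ k) (P, PA)) \<noteq> (?f ^^ k) (P, PA)"
    then show "m (?f ((?f ^^ k) (P, PA))) < m ((?f ^^ k) (P, PA))"
      using decr[of k] unassigned[of k] unassigned[of "Suc k"] by (intro strict) auto
  next
    show "m (P, PA) \<le> loop_bound c"
      unfolding m_def loop_bound_def
      by (intro add_mono card_mono finite_assigned_vars finite_assigned_arrs) auto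
  qed
qed

section \<open>Intermediate commands of the translation\<close>

abbreviation enter_flag :: "label \<Rightarrow> bexp \<Rightarrow> aexp" where
  "enter_flag l be \<equiv> ACond (Bl l be) (AVar bvar) (ANum 1)"

abbreviation exit_flag :: "label \<Rightarrow> bexp \<Rightarrow> aexp" where
  "exit_flag l be \<equiv> ACond (Bl l be) (ANum 1) (AVar bvar)"

abbreviation mask_val :: "vname \<Rightarrow> aexp" where
  "mask_val X \<equiv> ACond (beq (AVar bvar) (ANum 1)) (ANum 0) (AVar X)"

abbreviation guard_idx :: "label \<Rightarrow> aexp \<Rightarrow> aexp" where
  "guard_idx l i \<equiv> if l then i else mask_idx i"

definition assign :: "vname \<Rightarrow> aexp \<Rightarrow> state \<Rightarrow> state" where
  "assign x e \<rho> = \<rho>(x := aval e \<rho>)"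

text \<open>These are the side conditions that stay the same while one loop runs:
  \<open>Q, QA\<close> is the loop invariant on labels, and the labels required after the loop may
  be weaker.\<close>

definition while_ok :: "label \<Rightarrow> bexp \<Rightarrow> plab \<Rightarrow> palab \<Rightarrow> plab \<Rightarrow> palab \<Rightarrow> bool" where
  "while_ok l be Q QA P' PA' \<longleftrightarrow> bvar \<notin> bvars be \<and> (l \<longrightarrow> lab_b Q be) \<and> P' \<le> Q \<and> PA' \<le> QA"

abbreviation loop_com :: "label \<Rightarrow> bexp \<Rightarrow> com \<Rightarrow> com" where
  "loop_com l be t \<equiv> While (Bl l be) (Seq (Asgn bvar (enter_flag l be)) t)"

text \<open>\<open>tr F s P PA t P' PA'\<close>: \<open>t\<close> is a command reached while running the translation, \<open>s\<close> the
  source command it corresponds to, and the labels \<open>P, PA\<close> before \<open>t\<close> become \<open>P', PA'\<close> after it.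
  \<open>F\<close> is the effect of an instrumentation assignment about to be executed: the labels and the
  source state refer to \<open>F \<rho>\<close> rather than to the actual state \<open>\<rho>\<close>.\<close>

inductive tr :: "(state \<Rightarrow> state) \<Rightarrow> com \<Rightarrow> plab \<Rightarrow> palab \<Rightarrow> com \<Rightarrow> plab \<Rightarrow> palab \<Rightarrow> bool" where
  tr_Skip: "\<lbrakk> P' \<le> P; PA' \<le> PA \<rbrakk> \<Longrightarrow> tr (\<lambda>\<rho>. \<rho>) Skip P PA Skip P' PA'"
| tr_Asgn: "\<lbrakk> x \<noteq> bvar; P' \<le> P(x := lab_a P e); PA' \<le> PA \<rbrakk> \<Longrightarrow>
            tr (\<lambda>\<rho>. \<rho>) (Asgn x e) P PA (Asgn x e) P' PA'"
| tr_Seq: "\<lbrakk> tr F s1 P PA t1 P1 PA1; tr (\<lambda>\<rho>. \<rho>) s2 P1 PA1 t2 P' PA' \<rbrakk> \<Longrightarrow>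
           tr F (Seq s1 s2) P PA (Seq t1 t2) P' PA'"
| tr_If: "\<lbrakk> bvar \<notin> bvars be; l \<longrightarrow> lab_b P be; tr (\<lambda>\<rho>. \<rho>) s1 P PA t1 P' PA'; tr (\<lambda>\<rho>. \<rho>) s2 P PA t2 P' PA' \<rbrakk> \<Longrightarrow>
          tr (\<lambda>\<rho>. \<rho>) (If be s1 s2) P PA
            (If (Bl l be) (Seq (Asgn bvar (enter_flag l be)) t1) (Seq (Asgn bvar (exit_flag l be)) t2))
            P' PA'"
| tr_While: "\<lbrakk> while_ok l be Q QA P' PA'; tr (\<lambda>\<rho>. \<rho>) s Q QA t Q QA; Q \<le> P; QA \<le> PA \<rbrakk> \<Longrightarrow>
             tr (\<lambda>\<rho>. \<rho>) (While be s) P PA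
               (Seq (loop_com l be t) (Asgn bvar (exit_flag l be))) P' PA'"
| tr_Unrolled: "\<lbrakk> while_ok l be Q QA P' PA'; tr (\<lambda>\<rho>. \<rho>) s Q QA t Q QA \<rbrakk> \<Longrightarrow>
             tr (\<lambda>\<rho>. \<rho>) (If be (Seq s (While be s)) Skip) Q QA
               (Seq (If (Bl l be) (Seq (Seq (Asgn bvar (enter_flag l be)) t) (loop_com l be t)) Skip)
                    (Asgn bvar (exit_flag l be))) P' PA'"
| tr_Body: "\<lbrakk> while_ok l be Q QA P' PA'; tr (\<lambda>\<rho>. \<rho>) s Q QA t Q QA; tr F s0 P PA t0 Q QA \<rbrakk> \<Longrightarrow>
             tr F (Seq s0 (While be s)) P PA
               (Seq (Seq t0 (loop_com l be t)) (Asgn bvar (exit_flag l be))) P' PA'"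
| tr_Read_Mask: "\<lbrakk> X \<noteq> bvar; lab_a P i; PA a; P' \<le> P(X := True); PA' \<le> PA \<rbrakk> \<Longrightarrow>
             tr (\<lambda>\<rho>. \<rho>) (ARead X a i) P PA (Seq (ARead X a i) (Asgn X (mask_val X))) P' PA'"
| tr_Read: "\<lbrakk> X \<noteq> bvar; l \<longrightarrow> lab_a P i; P' \<le> P(X := False); PA' \<le> PA \<rbrakk> \<Longrightarrow>
             tr (\<lambda>\<rho>. \<rho>) (ARead X a i) P PA (ARead X a (guard_idx l i)) P' PA'"
| tr_Write: "\<lbrakk> l \<longrightarrow> lab_a P i; P' \<le> P; PA' \<le> PA(a := PA a \<and> lab_a P e) \<rbrakk> \<Longrightarrow>
             tr (\<lambda>\<rho>. \<rho>) (AWrite a i e) P PA (AWrite a (guard_idx l i) e) P' PA'"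
| tr_Pending_Seq: "tr (\<lambda>\<rho>. \<rho>) s P PA t P' PA' \<Longrightarrow> tr (assign x e) s P PA (Seq (Asgn x e) t) P' PA'"
| tr_Pending: "\<lbrakk> P' \<le> P; PA' \<le> PA \<rbrakk> \<Longrightarrow> tr (assign x e) Skip P PA (Asgn x e) P' PA'"
| tr_Skip_Seq: "tr F s P PA t P' PA' \<Longrightarrow> tr F s P PA (Seq Skip t) P' PA'"

lemma tr_target_Skip:
  assumes "tr F s P PA Skip P' PA'"
  shows "F = (\<lambda>\<rho>. \<rho>)" "s = Skip" "P' \<le> P" "PA' \<le> PA"
  using assms by (cases rule: tr.cases; auto split: if_splits)+

text \<open>The final labels are only bounded by the result of the analysis, since the two branches
  of a conditional need common final labels and a loop body must end in the labels it started
  from.\<close>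

lemma tr_fsfvslh:
  "bvar \<notin> used_vars c \<Longrightarrow> P' \<le> fst (snd (ifc c P PA pc)) \<Longrightarrow> PA' \<le> snd (snd (ifc c P PA pc)) \<Longrightarrow>
   tr (\<lambda>\<rho>. \<rho>) c P PA (fsfvslh (fst (ifc c P PA pc))) P' PA'"
proof (induction c arbitrary: P PA pc P' PA')
  case (Seq c1 c2)
  obtain h1 P1 PA1 where 1: "ifc c1 P PA pc = (h1, P1, PA1)" by (metis prod_cases3)
  obtain h2 P2 PA2 where 2: "ifc c2 P1 PA1 pc = (h2, P2, PA2)" by (metis prod_cases3)
  show ?case
    using Seq.prems Seq.IH(1)[of P1 P PA pc PA1] Seq.IH(2)[of P' P1 PA1 pc PA'] 1 2
    by (auto intro: tr_Seq)
next
  case (If be c1 c2)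
  let ?pc = "pc \<and> lab_b P be"
  obtain h1 P1 PA1 where 1: "ifc c1 P PA ?pc = (h1, P1, PA1)" by (metis prod_cases3)
  obtain h2 P2 PA2 where 2: "ifc c2 P PA ?pc = (h2, P2, PA2)" by (metis prod_cases3)
  show ?case
    using If.prems If.IH(1)[of P' P PA ?pc PA'] If.IH(2)[of P' P PA ?pc PA'] 1 2
    by (auto simp: join_lab_inf simp del: One_nat_def intro!: tr_If)
next
  case (While be c)
  obtain Q QA where fixp: "(loop_lab be c pc (P, PA) ^^ loop_bound c) (P, PA) = (Q, QA)"
    by fastforce
  let ?pc = "pc \<and> lab_b Q be"
  \<comment> \<open>The fixpoint equation splits into two inequalities: one makes
    \<open>Q, QA\<close> invariant under the body, the other lets the loop be entered from
    \<open>P, PA\<close>.\<close>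
  from loop_lab_fixpoint[of be c pc P PA] fixp
  have "inf (snd (ifc c Q QA ?pc)) (P, PA) = (Q, QA)" by (simp add: loop_lab_def)
  then have "(Q, QA) \<le> snd (ifc c Q QA ?pc)" "(Q, QA) \<le> (P, PA)"
    by (metis inf.cobounded1, metis inf.cobounded2)
  then have le: "Q \<le> fst (snd (ifc c Q QA ?pc))" "QA \<le> snd (snd (ifc c Q QA ?pc))" "Q \<le> P" "QA \<le> PA"
    by (simp_all add: less_eq_prod_def)
  have "tr (\<lambda>\<rho>. \<rho>) c Q QA (fsfvslh (fst (ifc c Q QA ?pc))) Q QA"
    using While.IH[OF _ le(1,2)] While.prems(1) by simp
  moreover have "while_ok (lab_b Q be) be Q QA P' PA'"
    using While.prems by (simp add: while_ok_def ifc_While fixp)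
  ultimately show ?case
    using tr_While le(3,4) by (simp add: ifc_While fixp del: One_nat_def)
next
  case (ARead X a i)
  let ?l = "pc \<and> lab_a P i \<and> PA a"
  show ?case
  proof (cases ?l)
    case True
    with ARead show ?thesis by (auto simp: Let_def simp del: One_nat_def intro!: tr_Read_Mask)
  next
    case False
    \<comment> \<open>The loaded variable becomes secret, so its value needs no mask; only a secret
      index is masked. A secret index always falls into this case.\<close>
    then have "P' \<le> P(X := False)"
      using ARead.prems(2) by (auto simp: Let_def le_fun_def)
    moreover have "PA' \<le> PA" "X \<noteq> bvar" using ARead.prems by (auto simp: Let_def)
    ultimately have "tr (\<lambda>\<rho>. \<rho>) (ARead X a i) P PA (ARead X a (guard_idx (lab_a P i) i)) P' PA'"
      by (intro tr_Read) auto
    with False show ?thesis by (auto simp: Let_def)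
  qed
next
  case (AWrite a i e)
  then have "P' \<le> P" "PA' \<le> PA(a := PA a \<and> lab_a P e)"
    by (auto simp: le_fun_def)
  then have "tr (\<lambda>\<rho>. \<rho>) (AWrite a i e) P PA (AWrite a (guard_idx (lab_a P i) i) e) P' PA'"
    by (intro tr_Write) auto
  then show ?case by auto
qed (auto intro: tr.intros)

section \<open>Lockstep execution\<close>

lemma seq_steps_single: "seq_step c \<rho> \<mu> os c' \<rho>' \<mu>' \<Longrightarrow> seq_steps c \<rho> \<mu> os c' \<rho>' \<mu>'"
  using Seqs_step[OF _ Seqs_refl] by fastforce

lemma seq_steps_trans:
  "seq_steps c \<rho> \<mu> os c' \<rho>' \<mu>' \<Longrightarrow> seq_steps c' \<rho>' \<mu>' os' c'' \<rho>'' \<mu>'' \<Longrightarrow>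
   seq_steps c \<rho> \<mu> (os @ os') c'' \<rho>'' \<mu>''"
  by (induction rule: seq_steps.induct) (auto intro: Seqs_step)

lemma seq_steps_Seq:
  "seq_steps c \<rho> \<mu> os c' \<rho>' \<mu>' \<Longrightarrow> seq_steps (Seq c d) \<rho> \<mu> os (Seq c' d) \<rho>' \<mu>'"
  by (induction rule: seq_steps.induct) (auto intro: seq_steps.intros Seq_Seq)

text \<open>The common observations made so far cancel from every later prefix comparison.\<close>

lemma seq_obs_equiv_steps:
  assumes "seq_obs_equiv c \<rho>1 \<mu>1 d \<rho>2 \<mu>2"
    and "seq_steps c \<rho>1 \<mu>1 os c' \<rho>1' \<mu>1'" and "seq_steps d \<rho>2 \<mu>2 os d' \<rho>2' \<mu>2'"
  shows "seq_obs_equiv c' \<rho>1' \<mu>1' d' \<rho>2' \<mu>2'"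
  using assms(1) seq_steps_trans[OF assms(2)] seq_steps_trans[OF assms(3)]
  unfolding seq_obs_equiv_def by (metis same_prefix_prefix)

lemma seq_obs_equiv_Seq:
  "seq_obs_equiv (Seq c d) \<rho>1 \<mu>1 (Seq c' d') \<rho>2 \<mu>2 \<Longrightarrow> seq_obs_equiv c \<rho>1 \<mu>1 c' \<rho>2 \<mu>2"
  unfolding seq_obs_equiv_def by (meson seq_steps_Seq)

lemma seq_obs_equiv_step:
  assumes "seq_obs_equiv c \<rho>1 \<mu>1 d \<rho>2 \<mu>2"
    and "seq_step c \<rho>1 \<mu>1 [o1] c' \<rho>1' \<mu>1'" and "seq_step d \<rho>2 \<mu>2 [o2] d' \<rho>2' \<mu>2'"
  shows "o1 = o2"
  using assms(1) assms(2,3)[THEN seq_steps_single] unfolding seq_obs_equiv_def by fastforce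

text \<open>Under misspeculation array contents are unconstrained, because unsafe stores may place
  secrets in public arrays.\<close>

definition low_eq :: "bool \<Rightarrow> plab \<Rightarrow> palab \<Rightarrow> state \<Rightarrow> mem \<Rightarrow> state \<Rightarrow> mem \<Rightarrow> bool" where
  "low_eq \<beta> P PA \<rho>1 \<mu>1 \<rho>2 \<mu>2 \<longleftrightarrow>
     \<rho>1 bvar = of_bool \<beta> \<and> \<rho>2 bvar = of_bool \<beta> \<and> pub_equiv P \<rho>1 \<rho>2 \<and>
     (\<not> \<beta> \<longrightarrow> pub_equiv PA \<mu>1 \<mu>2)"

lemma low_eq_mono:
  "low_eq \<beta> P PA \<rho>1 \<mu>1 \<rho>2 \<mu>2 \<Longrightarrow> Q \<le> P \<Longrightarrow> QA \<le> PA \<Longrightarrow> low_eq \<beta> Q QA \<rho>1 \<mu>1 \<rho>2 \<mu>2"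
  by (auto simp: low_eq_def intro: pub_equiv_mono)

lemma bval_Bl: "bval (Bl l be) \<rho> \<longleftrightarrow> (l \<or> \<rho> bvar = 0) \<and> bval be \<rho>"
  by (simp add: Bl_def band_def beq_def)

lemma aval_guard_idx: "aval (guard_idx l i) \<rho> = (if \<not> l \<and> \<rho> bvar = 1 then 0 else aval i \<rho>)"
  by (simp add: mask_idx_def beq_def)

text \<open>This is the part of the simulation invariant to be restored after a target step. The
  source may take no step at all, since instrumentation has no counterpart there, and after
  misspeculation it need not follow. The final labels stay fixed, so that the relation composes
  under sequencing.\<close>

definition advance ::
  "com \<Rightarrow> state \<Rightarrow> mem \<Rightarrow> state \<Rightarrow> mem \<Rightarrow> obs list \<Rightarrow> com \<Rightarrow> plab \<Rightarrow> palab \<Rightarrow>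
   bool \<Rightarrow> state \<Rightarrow> mem \<Rightarrow> state \<Rightarrow> mem \<Rightarrow> bool" where
  "advance s \<sigma>1 \<mu>1 \<sigma>2 \<mu>2 os t P' PA' \<beta> \<rho>1' \<mu>1' \<rho>2' \<mu>2' \<longleftrightarrow>
     (\<exists>F s' P PA. tr F s' P PA t P' PA' \<and> low_eq \<beta> P PA (F \<rho>1') \<mu>1' (F \<rho>2') \<mu>2' \<and>
        (\<not> \<beta> \<longrightarrow> seq_steps s \<sigma>1 \<mu>1 os s' (F \<rho>1') \<mu>1' \<and> seq_steps s \<sigma>2 \<mu>2 os s' (F \<rho>2') \<mu>2'))"

lemma advanceI:
  assumes "tr F s' P PA t P' PA'" "low_eq \<beta> P PA (F \<rho>1') \<mu>1' (F \<rho>2') \<mu>2'"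
    and "\<not> \<beta> \<Longrightarrow> seq_steps s \<sigma>1 \<mu>1 os s' (F \<rho>1') \<mu>1'"
    and "\<not> \<beta> \<Longrightarrow> seq_steps s \<sigma>2 \<mu>2 os s' (F \<rho>2') \<mu>2'"
  shows "advance s \<sigma>1 \<mu>1 \<sigma>2 \<mu>2 os t P' PA' \<beta> \<rho>1' \<mu>1' \<rho>2' \<mu>2'"
  using assms unfolding advance_def by blast

section \<open>Lockstep of single target steps\<close>

inductive_cases spec_SkipE: "spec_step Skip \<rho> \<mu> \<beta> ds os t' \<rho>' \<mu>' \<beta>'"
inductive_cases spec_AsgnE: "spec_step (Asgn x e) \<rho> \<mu> \<beta> ds os t' \<rho>' \<mu>' \<beta>'"
inductive_cases spec_SeqE: "spec_step (Seq t u) \<rho> \<mu> \<beta> ds os t' \<rho>' \<mu>' \<beta>'"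
inductive_cases spec_IfE: "spec_step (If be t u) \<rho> \<mu> \<beta> ds os t' \<rho>' \<mu>' \<beta>'"
inductive_cases spec_WhileE: "spec_step (While be t) \<rho> \<mu> \<beta> ds os t' \<rho>' \<mu>' \<beta>'"
inductive_cases spec_ReadE: "spec_step (ARead X a i) \<rho> \<mu> \<beta> ds os t' \<rho>' \<mu>' \<beta>'"
inductive_cases spec_WriteE: "spec_step (AWrite a i e) \<rho> \<mu> \<beta> ds os t' \<rho>' \<mu>' \<beta>'"

text \<open>A secret condition is safe to branch on: before misspeculation its value is a source
  observation, and afterwards the translation has turned it into false.\<close>

lemma branch_lockstep:
  assumes "low_eq \<beta> P PA \<rho>1 \<mu>1 \<rho>2 \<mu>2" "l \<longrightarrow> lab_b P be"
    and "\<not> \<beta> \<Longrightarrow> seq_obs_equiv (If be s1 s2) \<rho>1 \<mu>1 (If be s1 s2) \<rho>2 \<mu>2"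
  shows "bval (Bl l be) \<rho>1 = bval (Bl l be) \<rho>2"
proof (cases "\<beta> \<or> l")
  case True
  then show ?thesis
    using assms(1,2) by (auto simp: bval_Bl low_eq_def dest: bval_pub_equiv)
next
  case False
  then have "bval be \<rho>1 = bval be \<rho>2"
    using seq_obs_equiv_step[OF assms(3) Seq_If Seq_If] by simp
  then show ?thesis
    using False assms(1) by (simp add: bval_Bl low_eq_def)
qed

text \<open>A public index agrees by its label, a secret one is masked to 0 under misspeculation,
  and the remaining case is left to the source runs.\<close>

lemma index_lockstep:
  assumes "low_eq \<beta> P PA \<rho>1 \<mu>1 \<rho>2 \<mu>2" "l \<longrightarrow> lab_a P i"
    and "\<not> \<beta> \<Longrightarrow> aval i \<rho>1 = aval i \<rho>2"
  shows "aval (guard_idx l i) \<rho>1 = aval (guard_idx l i) \<rho>2"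
  using assms aval_pub_equiv[of P \<rho>1 \<rho>2 i] unfolding aval_guard_idx
  by (cases \<beta>; cases l) (auto simp: low_eq_def)

text \<open>Both runs write the same value to \<open>bvar\<close>, whatever its label. Since the
  flag can only rise, array equivalence is still at hand whenever \<beta>' is false.\<close>

lemma low_eq_flag:
  assumes "low_eq \<beta> P PA \<rho>1 \<mu>1 \<rho>2 \<mu>2" "aval e \<rho>1 = of_bool \<beta>'" "aval e \<rho>2 = of_bool \<beta>'" "\<beta> \<longrightarrow> \<beta>'"
  shows "low_eq \<beta>' P PA (assign bvar e \<rho>1) \<mu>1 (assign bvar e \<rho>2) \<mu>2"
  using assms by (auto simp: low_eq_def assign_def pub_equiv_def)

lemma spec_If_result:
  "spec_step (If be u1 u2) \<rho> \<mu> \<beta> ds os v \<rho>' \<mu>' \<beta>' \<Longrightarrow>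
   v = (if bval be \<rho> \<noteq> (ds = [DForce]) then u1 else u2) \<and> os = [OBranch (bval be \<rho>)] \<and>
   \<beta>' = (\<beta> \<or> ds = [DForce]) \<and> \<rho>' = \<rho> \<and> \<mu>' = \<mu>"
  by (auto elim!: spec_IfE)

text \<open>The branch leaves the state unchanged, so the pending assignment evaluates the same
  condition again and detects a forced branch. \<open>K\<close> is the context of the conditional:
  trivial for a conditional of the program, the final flag assignment for an unrolled loop.\<close>

lemma branch_advance:
  assumes low: "low_eq \<beta> P PA \<rho>1 \<mu>1 \<rho>2 \<mu>2" and lab: "l \<longrightarrow> lab_b P be"
    and equiv: "\<not> \<beta> \<Longrightarrow> seq_obs_equiv (If be s1 s2) \<rho>1 \<mu>1 (If be s1 s2) \<rho>2 \<mu>2"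
    and step1: "spec_step (If (Bl l be) u1 u2) \<rho>1 \<mu>1 \<beta> ds os1 v1 \<rho>1' \<mu>1' \<beta>1"
    and step2: "spec_step (If (Bl l be) u1 u2) \<rho>2 \<mu>2 \<beta> ds os2 v2 \<rho>2' \<mu>2' \<beta>2"
    and tr1: "tr (assign bvar (enter_flag l be)) s1 P PA (K u1) P' PA'"
    and tr2: "tr (assign bvar (exit_flag l be)) s2 P PA (K u2) P' PA'"
  shows "os1 = os2 \<and> v1 = v2 \<and> \<beta>1 = \<beta>2 \<and>
         advance (If be s1 s2) \<rho>1 \<mu>1 \<rho>2 \<mu>2 os1 (K v1) P' PA' \<beta>1 \<rho>1' \<mu>1' \<rho>2' \<mu>2'"
proof -
  let ?v = "bval (Bl l be) \<rho>1"
  have v: "bval (Bl l be) \<rho>2 = ?v" using branch_lockstep[OF low lab equiv] by simp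
  have b: "\<rho>1 bvar = of_bool \<beta>" "\<rho>2 bvar = of_bool \<beta>" using low by (simp_all add: low_eq_def)
  \<comment> \<open>\<open>w\<close> records which branch is entered; it differs from the value of
    the condition exactly when the branch is forced.\<close>
  define w where "w \<longleftrightarrow> ?v \<noteq> (ds = [DForce])"
  have w: "v1 = (if w then u1 else u2)" "v2 = v1" "os1 = [OBranch ?v]" "os2 = os1"
      "\<beta>1 = (\<beta> \<or> w \<noteq> ?v)" "\<beta>2 = \<beta>1" "\<rho>1' = \<rho>1" "\<rho>2' = \<rho>2" "\<mu>1' = \<mu>1" "\<mu>2' = \<mu>2"
    using spec_If_result[OF step1] spec_If_result[OF step2] v by (auto simp: w_def)
  let ?e = "if w then enter_flag l be else exit_flag l be"
  let ?s = "if w then s1 else s2"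
  have "tr (assign bvar ?e) ?s P PA (K v1) P' PA'" using tr1 tr2 w by auto
  moreover have "low_eq \<beta>1 P PA (assign bvar ?e \<rho>1') \<mu>1' (assign bvar ?e \<rho>2') \<mu>2'"
  proof -
    have "aval ?e \<rho>1 = of_bool \<beta>1" "aval ?e \<rho>2 = of_bool \<beta>1" "\<beta> \<longrightarrow> \<beta>1"
      using w(5) v b by auto
    from low_eq_flag[OF low this] show ?thesis using w by simp
  qed
  moreover have "seq_steps (If be s1 s2) \<rho>1 \<mu>1 os1 ?s (assign bvar ?e \<rho>1') \<mu>1'"
      "seq_steps (If be s1 s2) \<rho>2 \<mu>2 os1 ?s (assign bvar ?e \<rho>2') \<mu>2'" if "\<not> \<beta>1"
  proof -
    \<comment> \<open>Without misspeculation the flag is 0, so the guard equals the source condition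
      and the pending assignment writes 0 over 0.\<close>
    have "bval be \<rho>1 = w" "bval be \<rho>2 = w" "?v = w"
      "assign bvar ?e \<rho>1 = \<rho>1" "assign bvar ?e \<rho>2 = \<rho>2"
      using that w v b by (auto simp: bval_Bl assign_def)
    then show "seq_steps (If be s1 s2) \<rho>1 \<mu>1 os1 ?s (assign bvar ?e \<rho>1') \<mu>1'"
      "seq_steps (If be s1 s2) \<rho>2 \<mu>2 os1 ?s (assign bvar ?e \<rho>2') \<mu>2'"
      using w Seq_If[THEN seq_steps_single, of be s1 s2] by metis+
  qed
  ultimately show ?thesis using w unfolding advance_def by metis
qed

lemma advance_Seq:
  assumes "advance s1 \<sigma>1 \<mu>1 \<sigma>2 \<mu>2 os t1 P1 PA1 \<beta> \<rho>1' \<mu>1' \<rho>2' \<mu>2'"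
    and "\<And>F s' P PA. tr F s' P PA t1 P1 PA1 \<Longrightarrow> tr F (Seq s' s2) P PA t P' PA'"
  shows "advance (Seq s1 s2) \<sigma>1 \<mu>1 \<sigma>2 \<mu>2 os t P' PA' \<beta> \<rho>1' \<mu>1' \<rho>2' \<mu>2'"
  using assms unfolding advance_def by (meson seq_steps_Seq)

text \<open>Before misspeculation the target can only read within bounds, so both source reads can
  step as well and their observations can be compared.\<close>

lemma read_index_lockstep:
  assumes "low_eq \<beta> P PA \<rho>1 \<mu>1 \<rho>2 \<mu>2" "l \<longrightarrow> lab_a P i"
    and "\<not> \<beta> \<Longrightarrow> seq_obs_equiv (ARead X a i) \<rho>1 \<mu>1 (ARead X a i) \<rho>2 \<mu>2"
    and "spec_step (ARead X a (guard_idx l i)) \<rho>1 \<mu>1 \<beta> ds os1 t1 \<rho>1' \<mu>1' \<beta>1"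
    and "spec_step (ARead X a (guard_idx l i)) \<rho>2 \<mu>2 \<beta> ds os2 t2 \<rho>2' \<mu>2' \<beta>2"
  shows "aval (guard_idx l i) \<rho>1 = aval (guard_idx l i) \<rho>2"
proof (rule index_lockstep[OF assms(1,2)])
  assume "\<not> \<beta>"
  then have "aval (guard_idx l i) \<rho>1 = aval i \<rho>1" "aval (guard_idx l i) \<rho>2 = aval i \<rho>2"
    using assms(1) by (simp_all only: aval_guard_idx) (simp_all add: low_eq_def)
  with assms(4,5) \<open>\<not> \<beta>\<close> have "aval i \<rho>1 < length (\<mu>1 a)" "aval i \<rho>2 < length (\<mu>2 a)"
    by (auto elim!: spec_ReadE simp del: if_split)
  with seq_obs_equiv_step[OF assms(3)[OF \<open>\<not> \<beta>\<close>] Seq_Read Seq_Read]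
  show "aval i \<rho>1 = aval i \<rho>2" by simp
qed

lemma write_index_lockstep:
  assumes "low_eq \<beta> P PA \<rho>1 \<mu>1 \<rho>2 \<mu>2" "l \<longrightarrow> lab_a P i"
    and "\<not> \<beta> \<Longrightarrow> seq_obs_equiv (AWrite a i e) \<rho>1 \<mu>1 (AWrite a i e) \<rho>2 \<mu>2"
    and "spec_step (AWrite a (guard_idx l i) e) \<rho>1 \<mu>1 \<beta> ds os1 t1 \<rho>1' \<mu>1' \<beta>1"
    and "spec_step (AWrite a (guard_idx l i) e) \<rho>2 \<mu>2 \<beta> ds os2 t2 \<rho>2' \<mu>2' \<beta>2"
  shows "aval (guard_idx l i) \<rho>1 = aval (guard_idx l i) \<rho>2"
proof (rule index_lockstep[OF assms(1,2)])
  assume "\<not> \<beta>"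
  then have "aval (guard_idx l i) \<rho>1 = aval i \<rho>1" "aval (guard_idx l i) \<rho>2 = aval i \<rho>2"
    using assms(1) by (simp_all only: aval_guard_idx) (simp_all add: low_eq_def)
  with assms(4,5) \<open>\<not> \<beta>\<close> have "aval i \<rho>1 < length (\<mu>1 a)" "aval i \<rho>2 < length (\<mu>2 a)"
    by (auto elim!: spec_WriteE simp del: if_split)
  with seq_obs_equiv_step[OF assms(3)[OF \<open>\<not> \<beta>\<close>] Seq_Write Seq_Write]
  show "aval i \<rho>1 = aval i \<rho>2" by simp
qed

text \<open>This serves target steps that execute pending instrumentation or drop a
  \<open>Skip\<close>: their effect is already included in the source state, so the source stands
  still.\<close>

lemma advance_silent:
  assumes "tr F' s P PA t P' PA'" "low_eq \<beta> P PA (F' \<rho>1') \<mu>1 (F' \<rho>2') \<mu>2"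
    and "F' \<rho>1' = \<sigma>1" "F' \<rho>2' = \<sigma>2"
  shows "advance s \<sigma>1 \<mu>1 \<sigma>2 \<mu>2 [] t P' PA' \<beta> \<rho>1' \<mu>1 \<rho>2' \<mu>2"
  using assms Seqs_refl unfolding advance_def by metis

text \<open>Induction on \<open>tr\<close>, each target step leading to another rule. A loop cycles
  through \<open>tr_While\<close>, \<open>tr_Unrolled\<close> and \<open>tr_Body\<close>, until the
  unrolled conditional is left and only the final flag assignment is pending.\<close>

lemma tr_step:
  assumes "tr F s P PA t P' PA'"
    and "low_eq \<beta> P PA (F \<rho>1) \<mu>1 (F \<rho>2) \<mu>2"
    and "\<not> \<beta> \<Longrightarrow> seq_obs_equiv s (F \<rho>1) \<mu>1 s (F \<rho>2) \<mu>2"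
    and "spec_step t \<rho>1 \<mu>1 \<beta> ds os1 t1 \<rho>1' \<mu>1' \<beta>1"
    and "spec_step t \<rho>2 \<mu>2 \<beta> ds os2 t2 \<rho>2' \<mu>2' \<beta>2"
  shows "os1 = os2 \<and> t1 = t2 \<and> \<beta>1 = \<beta>2 \<and>
         advance s (F \<rho>1) \<mu>1 (F \<rho>2) \<mu>2 os1 t1 P' PA' \<beta>1 \<rho>1' \<mu>1' \<rho>2' \<mu>2'"
  using assms
proof (induction arbitrary: t1 t2 rule: tr.induct)
  case (tr_Skip P' P PA' PA)
  then show ?case by (auto elim: spec_SkipE)
next
  case (tr_Asgn x P' P e PA' PA)
  have "low_eq \<beta> (P(x := lab_a P e)) PA (\<rho>1(x := aval e \<rho>1)) \<mu>1 (\<rho>2(x := aval e \<rho>2)) \<mu>2"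
    using tr_Asgn.hyps tr_Asgn.prems(1) by (auto simp: low_eq_def pub_equiv_def intro: aval_pub_equiv[of P])
  then have "advance (Asgn x e) \<rho>1 \<mu>1 \<rho>2 \<mu>2 [] Skip P' PA' \<beta>
      (\<rho>1(x := aval e \<rho>1)) \<mu>1 (\<rho>2(x := aval e \<rho>2)) \<mu>2"
    by (rule advanceI[where F = "\<lambda>\<rho>. \<rho>", OF tr.tr_Skip[OF tr_Asgn.hyps(2,3)]])
      (auto intro: seq_steps_single Seq_Asgn)
  with tr_Asgn.prems(3,4) show ?case by (auto elim!: spec_AsgnE)
next
  case (tr_Seq F s1 P PA u1 P1 PA1 s2 u2 P' PA')
  show ?case
  proof (cases "u1 = Skip")
    case True
    note tgt = tr_target_Skip[OF tr_Seq.hyps(1)[unfolded True]]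
    have "advance (Seq s1 s2) (F \<rho>1) \<mu>1 (F \<rho>2) \<mu>2 [] u2 P' PA' \<beta> \<rho>1 \<mu>1 \<rho>2 \<mu>2"
      using low_eq_mono[OF tr_Seq.prems(1) tgt(3,4)] unfolding tgt(1,2)
      by (intro advanceI[where F = "\<lambda>\<rho>. \<rho>", OF tr_Seq.hyps(2)]) (auto intro: seq_steps_single Seq_Skip)
    with tr_Seq.prems(3,4) True show ?thesis by (auto elim!: spec_SeqE elim: spec_SkipE)
  next
    case False
    with tr_Seq.prems(3,4) obtain v1 v2 where v: "t1 = Seq v1 u2" "t2 = Seq v2 u2"
      "spec_step u1 \<rho>1 \<mu>1 \<beta> ds os1 v1 \<rho>1' \<mu>1' \<beta>1" "spec_step u1 \<rho>2 \<mu>2 \<beta> ds os2 v2 \<rho>2' \<mu>2' \<beta>2"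
      by (auto elim!: spec_SeqE)
    from tr_Seq.IH(1)[OF tr_Seq.prems(1) _ v(3,4)] tr_Seq.prems(2) v(1,2) tr_Seq.hyps(2)
    show ?thesis by (auto dest: seq_obs_equiv_Seq intro: advance_Seq tr.tr_Seq)
  qed
next
  case (tr_If be l s1 P PA u1 P' PA' s2 u2)
  from tr_If.prems tr_If.hyps show ?case
    by (intro branch_advance[where K = "\<lambda>t. t"]) (auto intro: tr_Pending_Seq)
next
  case (tr_While l be Q QA P' PA' s u P PA)
  have "advance (While be s) \<rho>1 \<mu>1 \<rho>2 \<mu>2 []
     (Seq (If (Bl l be) (Seq (Seq (Asgn bvar (enter_flag l be)) u) (loop_com l be u)) Skip)
                    (Asgn bvar (exit_flag l be))) P' PA' \<beta> \<rho>1 \<mu>1 \<rho>2 \<mu>2"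
    using low_eq_mono[OF tr_While.prems(1) tr_While.hyps(3,4)]
    by (intro advanceI[where F = "\<lambda>\<rho>. \<rho>", OF tr_Unrolled[OF tr_While.hyps(1,2)]]) (auto intro: seq_steps_single Seq_While)
  with tr_While.prems(3,4) show ?case by (auto elim!: spec_SeqE spec_WhileE)
next
  case (tr_Unrolled l be Q QA P' PA' s u)
  let ?asg = "Asgn bvar (exit_flag l be)"
  let ?if = "If (Bl l be) (Seq (Seq (Asgn bvar (enter_flag l be)) u) (loop_com l be u)) Skip"
  obtain v1 v2 where v: "t1 = Seq v1 ?asg" "t2 = Seq v2 ?asg"
      "spec_step ?if \<rho>1 \<mu>1 \<beta> ds os1 v1 \<rho>1' \<mu>1' \<beta>1" "spec_step ?if \<rho>2 \<mu>2 \<beta> ds os2 v2 \<rho>2' \<mu>2' \<beta>2"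
    using tr_Unrolled.prems(3,4) by (auto elim!: spec_SeqE)
  have "tr (assign bvar (enter_flag l be)) (Seq s (While be s)) Q QA
      (Seq (Seq (Seq (Asgn bvar (enter_flag l be)) u) (loop_com l be u)) ?asg) P' PA'"
    using tr_Unrolled.hyps by (intro tr_Body tr_Pending_Seq)
  \<comment> \<open>On leaving the loop the source is already finished, while the target still has
    to update the flag.\<close>
  moreover have "tr (assign bvar (exit_flag l be)) Skip Q QA (Seq Skip ?asg) P' PA'"
    using tr_Unrolled.hyps(1) by (auto simp: while_ok_def intro: tr_Skip_Seq tr_Pending)
  moreover have "l \<longrightarrow> lab_b Q be"
    using tr_Unrolled.hyps(1) by (simp add: while_ok_def)
  ultimately show ?case
    using branch_advance[where K = "\<lambda>t. Seq t ?asg", OF tr_Unrolled.prems(1) _ tr_Unrolled.prems(2) v(3,4)] v(1,2)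
    by blast
next
  case (tr_Body l be Q QA P' PA' s u F s0 P PA u0)
  let ?asg = "Asgn bvar (exit_flag l be)" and ?W = "loop_com l be u"
  show ?case
  proof (cases "u0 = Skip")
    case True
    note tgt = tr_target_Skip[OF tr_Body.hyps(3)[unfolded True]]
    have "advance (Seq s0 (While be s)) (F \<rho>1) \<mu>1 (F \<rho>2) \<mu>2 [] (Seq ?W ?asg) P' PA' \<beta> \<rho>1 \<mu>1 \<rho>2 \<mu>2"
      using tr_Body.prems(1) unfolding tgt(1,2)
      by (intro advanceI[where F = "\<lambda>\<rho>. \<rho>", OF tr_While[OF tr_Body.hyps(1,2) tgt(3,4)]]) (auto intro: seq_steps_single Seq_Skip)
    with tr_Body.prems(3,4) True show ?thesis by (auto elim!: spec_SeqE elim: spec_SkipE)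
  next
    case False
    with tr_Body.prems(3,4) obtain v1 v2 where v: "t1 = Seq (Seq v1 ?W) ?asg" "t2 = Seq (Seq v2 ?W) ?asg"
      "spec_step u0 \<rho>1 \<mu>1 \<beta> ds os1 v1 \<rho>1' \<mu>1' \<beta>1" "spec_step u0 \<rho>2 \<mu>2 \<beta> ds os2 v2 \<rho>2' \<mu>2' \<beta>2"
      by (auto elim!: spec_SeqE)
    have "os1 = os2 \<and> v1 = v2 \<and> \<beta>1 = \<beta>2 \<and>
        advance s0 (F \<rho>1) \<mu>1 (F \<rho>2) \<mu>2 os1 v1 Q QA \<beta>1 \<rho>1' \<mu>1' \<rho>2' \<mu>2'"
      using tr_Body.prems(2) by (intro tr_Body.IH(2)[OF tr_Body.prems(1) _ v(3,4)]) (rule seq_obs_equiv_Seq)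
    then show ?thesis
      using v(1,2) advance_Seq[OF _ tr.tr_Body[OF tr_Body.hyps(1,2)]] by blast
  qed
next
  case (tr_Read_Mask X P i PA a P' PA')
  let ?asg = "Asgn X (mask_val X)"
  obtain v1 v2 where v: "t1 = Seq v1 ?asg" "t2 = Seq v2 ?asg"
      "spec_step (ARead X a i) \<rho>1 \<mu>1 \<beta> ds os1 v1 \<rho>1' \<mu>1' \<beta>1"
      "spec_step (ARead X a i) \<rho>2 \<mu>2 \<beta> ds os2 v2 \<rho>2' \<mu>2' \<beta>2"
    using tr_Read_Mask.prems(3,4) by (auto elim!: spec_SeqE)
  have idx: "aval i \<rho>1 = aval i \<rho>2"
    using read_index_lockstep[where l = True and i = i] tr_Read_Mask.prems(1,2) tr_Read_Mask.hyps(2) v(3,4)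
    by fastforce
  have step: "v1 = Skip" "v2 = Skip" "os1 = [ORead a (aval i \<rho>1)]" "os2 = os1" "\<beta>1 = \<beta>" "\<beta>2 = \<beta>"
    "\<mu>1' = \<mu>1" "\<mu>2' = \<mu>2"
    using v(3,4) idx by (auto elim!: spec_ReadE)
  obtain x1 x2 where x: "\<rho>1' = \<rho>1(X := x1)" "\<rho>2' = \<rho>2(X := x2)"
    "\<not> \<beta> \<Longrightarrow> x1 = \<mu>1 a ! aval i \<rho>1 \<and> aval i \<rho>1 < length (\<mu>1 a)"
    "\<not> \<beta> \<Longrightarrow> x2 = \<mu>2 a ! aval i \<rho>2 \<and> aval i \<rho>2 < length (\<mu>2 a)"
    using v(3,4) by (auto elim!: spec_ReadE)
  let ?F = "assign X (mask_val X)"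
  have tr': "tr ?F Skip (P(X := True)) PA (Seq Skip ?asg) P' PA'"
    using tr_Read_Mask.hyps by (intro tr_Skip_Seq tr_Pending)
  \<comment> \<open>The mask is counted as executed at once. It justifies the public label of
    \<open>X\<close>: under misspeculation both values become 0, otherwise both are the same entry
    of a public array.\<close>
  have F: "?F \<rho>1' = \<rho>1(X := if \<beta> then 0 else x1)" "?F \<rho>2' = \<rho>2(X := if \<beta> then 0 else x2)"
    using tr_Read_Mask.prems(1) tr_Read_Mask.hyps(1) x(1,2)
    by (auto simp: assign_def beq_def low_eq_def fun_eq_iff)
  have "low_eq \<beta> (P(X := True)) PA (?F \<rho>1') \<mu>1 (?F \<rho>2') \<mu>2"
    unfolding F using tr_Read_Mask.prems(1) tr_Read_Mask.hyps(1,3) x(3,4) idx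
    by (auto simp: low_eq_def pub_equiv_def)
  moreover have "seq_steps (ARead X a i) \<rho>1 \<mu>1 os1 Skip (?F \<rho>1') \<mu>1"
    "seq_steps (ARead X a i) \<rho>2 \<mu>2 os1 Skip (?F \<rho>2') \<mu>2" if "\<not> \<beta>"
    using that x(3,4) idx unfolding F step by (auto intro!: seq_steps_single Seq_Read)
  ultimately show ?case
    using advanceI[where F = ?F, OF tr'] step v(1,2) by auto
next
  case (tr_Read X l P i P' PA' PA a)
  have idx: "aval (guard_idx l i) \<rho>1 = aval (guard_idx l i) \<rho>2"
    using read_index_lockstep[OF _ tr_Read.hyps(2) _ tr_Read.prems(3,4)] tr_Read.prems(1,2) by fastforce
  let ?i = "guard_idx l i"
  have step: "t1 = Skip" "t2 = Skip" "os1 = [ORead a (aval ?i \<rho>1)]" "os2 = os1" "\<beta>1 = \<beta>" "\<beta>2 = \<beta>"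
    "\<mu>1' = \<mu>1" "\<mu>2' = \<mu>2"
    using tr_Read.prems(3,4) idx by (auto elim!: spec_ReadE simp del: if_split)
  obtain x1 x2 where x: "\<rho>1' = \<rho>1(X := x1)" "\<rho>2' = \<rho>2(X := x2)"
    "\<not> \<beta> \<Longrightarrow> x1 = \<mu>1 a ! aval ?i \<rho>1 \<and> aval ?i \<rho>1 < length (\<mu>1 a)"
    "\<not> \<beta> \<Longrightarrow> x2 = \<mu>2 a ! aval ?i \<rho>2 \<and> aval ?i \<rho>2 < length (\<mu>2 a)"
    using tr_Read.prems(3,4) by (auto elim!: spec_ReadE simp del: if_split)
  \<comment> \<open>As \<open>X\<close> is secret now, nothing is claimed about the loaded values,
    which a misspeculated load may take from any array.\<close>
  have low: "low_eq \<beta> (P(X := False)) PA \<rho>1' \<mu>1 \<rho>2' \<mu>2"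
    using tr_Read.prems(1) tr_Read.hyps(1) x(1,2) by (auto simp: low_eq_def pub_equiv_def)
  have "seq_steps (ARead X a i) \<rho>1 \<mu>1 os1 Skip \<rho>1' \<mu>1"
    "seq_steps (ARead X a i) \<rho>2 \<mu>2 os1 Skip \<rho>2' \<mu>2" if "\<not> \<beta>"
  proof -
    have "aval ?i \<rho>1 = aval i \<rho>1" "aval ?i \<rho>2 = aval i \<rho>2"
      using tr_Read.prems(1) that by (simp_all only: aval_guard_idx) (simp_all add: low_eq_def)
    then show "seq_steps (ARead X a i) \<rho>1 \<mu>1 os1 Skip \<rho>1' \<mu>1"
      "seq_steps (ARead X a i) \<rho>2 \<mu>2 os1 Skip \<rho>2' \<mu>2"
      using that x idx step(3) by (auto intro!: seq_steps_single Seq_Read simp del: if_split)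
  qed
  then show ?case
    using advanceI[where F = "\<lambda>\<rho>. \<rho>", OF tr.tr_Skip[OF tr_Read.hyps(3,4)] low] step by blast
next
  case (tr_Write l P i P' PA' PA a e)
  have idx: "aval (guard_idx l i) \<rho>1 = aval (guard_idx l i) \<rho>2"
    using write_index_lockstep[OF _ tr_Write.hyps(1) _ tr_Write.prems(3,4)] tr_Write.prems(1,2) by fastforce
  let ?i = "guard_idx l i"
  let ?PA = "PA(a := PA a \<and> lab_a P e)"
  have step: "t1 = Skip" "t2 = Skip" "os1 = [OWrite a (aval ?i \<rho>1)]" "os2 = os1" "\<beta>1 = \<beta>" "\<beta>2 = \<beta>"
    "\<rho>1' = \<rho>1" "\<rho>2' = \<rho>2"
    using tr_Write.prems(3,4) idx by (auto elim!: spec_WriteE simp del: if_split)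
  have m: "\<mu>1' = \<mu>1(a := (\<mu>1 a)[aval i \<rho>1 := aval e \<rho>1])" "aval i \<rho>1 < length (\<mu>1 a)"
     "\<mu>2' = \<mu>2(a := (\<mu>2 a)[aval i \<rho>2 := aval e \<rho>2])" "aval i \<rho>2 < length (\<mu>2 a)"
     "aval ?i \<rho>1 = aval i \<rho>1" "aval i \<rho>1 = aval i \<rho>2" if "\<not> \<beta>"
  proof -
    have i: "aval ?i \<rho>1 = aval i \<rho>1" "aval ?i \<rho>2 = aval i \<rho>2"
      using tr_Write.prems(1) that by (simp_all only: aval_guard_idx) (simp_all add: low_eq_def)
    then show "\<mu>1' = \<mu>1(a := (\<mu>1 a)[aval i \<rho>1 := aval e \<rho>1])" "aval i \<rho>1 < length (\<mu>1 a)"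
     "\<mu>2' = \<mu>2(a := (\<mu>2 a)[aval i \<rho>2 := aval e \<rho>2])" "aval i \<rho>2 < length (\<mu>2 a)"
      using that tr_Write.prems(3,4) by (auto elim!: spec_WriteE simp del: if_split)
    show "aval ?i \<rho>1 = aval i \<rho>1" "aval i \<rho>1 = aval i \<rho>2" using i idx by simp_all
  qed
  \<comment> \<open>Under misspeculation no claim about memory is made. Otherwise both stores hit
    the same position of \<open>a\<close>, and \<open>a\<close> stays public only if the stored
    values agree.\<close>
  have low: "low_eq \<beta> P ?PA \<rho>1 \<mu>1' \<rho>2 \<mu>2'"
    using tr_Write.prems(1) m aval_pub_equiv[of P \<rho>1 \<rho>2 e] by (cases \<beta>) (auto simp: low_eq_def pub_equiv_def)
  have "seq_steps (AWrite a i e) \<rho>1 \<mu>1 os1 Skip \<rho>1 \<mu>1'"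
    "seq_steps (AWrite a i e) \<rho>2 \<mu>2 os1 Skip \<rho>2 \<mu>2'" if "\<not> \<beta>"
    using m[OF that] step(3) by (auto intro!: seq_steps_single Seq_Write simp del: if_split)
  then show ?case
    using advanceI[where F = "\<lambda>\<rho>. \<rho>", OF tr.tr_Skip[OF tr_Write.hyps(2,3)] low] step by blast
next
  case (tr_Pending_Seq s P PA u P' PA' x e)
  have "advance s (assign x e \<rho>1) \<mu>1 (assign x e \<rho>2) \<mu>2 [] (Seq Skip u) P' PA' \<beta>
      (assign x e \<rho>1) \<mu>1 (assign x e \<rho>2) \<mu>2"
    using tr_Pending_Seq.hyps tr_Pending_Seq.prems(1) 
    by (intro advance_silent[where F' = "\<lambda>\<rho>. \<rho>", OF tr.tr_Skip_Seq]) auto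
  with tr_Pending_Seq.prems(3,4) show ?case
    unfolding assign_def by (auto elim!: spec_SeqE spec_AsgnE simp del: fun_upd_apply)
next
  case (tr_Pending P' P PA' PA x e)
  have "advance Skip (assign x e \<rho>1) \<mu>1 (assign x e \<rho>2) \<mu>2 [] Skip P' PA' \<beta>
      (assign x e \<rho>1) \<mu>1 (assign x e \<rho>2) \<mu>2"
    using tr_Pending.prems(1)
    by (intro advance_silent[where F' = "\<lambda>\<rho>. \<rho>", OF tr.tr_Skip[OF tr_Pending.hyps]]) auto
  with tr_Pending.prems(3,4) show ?case
    unfolding assign_def by (auto elim!: spec_AsgnE simp del: fun_upd_apply)
next
  case (tr_Skip_Seq F s P PA u P' PA')
  have "advance s (F \<rho>1) \<mu>1 (F \<rho>2) \<mu>2 [] u P' PA' \<beta> \<rho>1 \<mu>1 \<rho>2 \<mu>2"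
    using tr_Skip_Seq.prems(1)
    by (intro advance_silent[OF tr_Skip_Seq.hyps]) auto
  with tr_Skip_Seq.prems(3,4) show ?case
    by (auto elim!: spec_SeqE elim: spec_SkipE)
qed

section \<open>From single steps to whole runs\<close>

text \<open>Every observation is paired with a directive. Hence a run that goes on after the
  directives are exhausted observes nothing more, which settles runs with different numbers of
  steps.\<close>

lemma spec_step_lengths:
  "spec_step c \<rho> \<mu> \<beta> ds os c' \<rho>' \<mu>' \<beta>' \<Longrightarrow> length os = length ds"
  by (induction rule: spec_step.induct) auto

lemma spec_steps_lengths:
  "spec_steps c \<rho> \<mu> \<beta> D O1 c' \<rho>' \<mu>' \<beta>' \<Longrightarrow> length O1 = length D"
  by (induction rule: spec_steps.induct) (auto dest: spec_step_lengths)

text \<open>The command alone decides whether a step consumes a directive, so a common directive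
  list is split at the same place in both runs.\<close>

lemma spec_step_length_unique:
  "spec_step c \<rho>1 \<mu>1 \<beta>1 ds1 os1 c1 \<rho>1' \<mu>1' \<beta>1' \<Longrightarrow>
   spec_step c \<rho>2 \<mu>2 \<beta>2 ds2 os2 c2 \<rho>2' \<mu>2' \<beta>2' \<Longrightarrow> length ds1 = length ds2"
  by (induction arbitrary: c2 rule: spec_step.induct)
    (auto elim: spec_SkipE spec_AsgnE spec_SeqE spec_IfE spec_WhileE spec_ReadE spec_WriteE)

text \<open>The misspeculation flag is never reset, so if it is false after a step, the equivalence
  of the source runs was available before it.\<close>

lemma spec_step_speculating:
  "spec_step c \<rho> \<mu> \<beta> ds os c' \<rho>' \<mu>' \<beta>' \<Longrightarrow> \<beta> \<Longrightarrow> \<beta>'"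
  by (induction rule: spec_step.induct) auto

lemma tr_steps:
  assumes "spec_steps t \<rho>1 \<mu>1 \<beta> D O1 t1 \<rho>1' \<mu>1' \<beta>1"
    and "spec_steps t \<rho>2 \<mu>2 \<beta> D O2 t2 \<rho>2' \<mu>2' \<beta>2"
    and "tr F s P PA t P' PA'" and "low_eq \<beta> P PA (F \<rho>1) \<mu>1 (F \<rho>2) \<mu>2"
    and "\<not> \<beta> \<Longrightarrow> seq_obs_equiv s (F \<rho>1) \<mu>1 s (F \<rho>2) \<mu>2"
  shows "O1 = O2"
  using assms
proof (induction arbitrary: \<rho>2 \<mu>2 O2 F s P PA rule: spec_steps.induct)
  case (Specs_refl c \<rho> \<mu> \<beta>)
  then show ?case using spec_steps_lengths by fastforce
next
  case (Specs_step c \<rho> \<mu> \<beta> ds os c' \<rho>' \<mu>' \<beta>' D' O' c'' \<rho>'' \<mu>'' \<beta>'')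
  note step1 = Specs_step.hyps(1) and IH = Specs_step.IH
    and tr = Specs_step.prems(2) and low = Specs_step.prems(3) and equiv = Specs_step.prems(4)
  from Specs_step.prems(1) show ?case
  proof (cases rule: spec_steps.cases)
    case Specs_refl
    then show ?thesis
      using spec_step_lengths[OF Specs_step.hyps(1)] spec_steps_lengths[OF Specs_step.hyps(2)] by simp
  next
    case (Specs_step ds2 os2 d \<rho>d \<mu>d \<beta>d D2 O2')
    have D: "ds2 = ds" "D2 = D'"
      using Specs_step(1) spec_step_length_unique[OF \<open>spec_step c \<rho> \<mu> \<beta> ds os c' \<rho>' \<mu>' \<beta>'\<close> Specs_step(3)]
      by simp_all
    have adv: "os = os2" "c' = d" "\<beta>' = \<beta>d"
        "advance s (F \<rho>) \<mu> (F \<rho>2) \<mu>2 os c' P' PA' \<beta>' \<rho>' \<mu>' \<rho>d \<mu>d"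
      using tr_step[OF tr low equiv step1 Specs_step(3)[unfolded D]] by blast+
    from adv(4) obtain F' s' Q QA where next': "tr F' s' Q QA c' P' PA'"
        "low_eq \<beta>' Q QA (F' \<rho>') \<mu>' (F' \<rho>d) \<mu>d"
        "\<not> \<beta>' \<Longrightarrow> seq_steps s (F \<rho>) \<mu> os s' (F' \<rho>') \<mu>' \<and> seq_steps s (F \<rho>2) \<mu>2 os s' (F' \<rho>d) \<mu>d"
      unfolding advance_def by blast
    \<comment> \<open>Both source runs produced the same observations \<open>os\<close>, so
      equivalence passes to the configurations they reached.\<close>
    have "seq_obs_equiv s' (F' \<rho>') \<mu>' s' (F' \<rho>d) \<mu>d" if "\<not> \<beta>'"
      using next'(3)[OF that] equiv spec_step_speculating[OF step1] that
      by (blast intro: seq_obs_equiv_steps)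
    from IH[OF Specs_step(4)[folded adv(2,3), unfolded D] next'(1,2) this]
    show ?thesis using Specs_step(2) adv(1) by simp
  qed
qed

theorem theorem3p6:
  fixes P :: plab and PA :: palab and c :: com
    and \<rho>1 \<rho>2 :: state and \<mu>1 \<mu>2 :: mem
    and hc :: acom and P' :: plab and PA' :: palab
  assumes "bvar \<notin> used_vars c"
    and "\<rho>1 bvar = 0" and "\<rho>2 bvar = 0"
    and "\<forall>a. 0 < length (\<mu>1 a)" and "\<forall>a. 0 < length (\<mu>2 a)"
    and "pub_equiv P \<rho>1 \<rho>2"
    and "pub_equiv PA \<mu>1 \<mu>2"
    and "seq_obs_equiv c \<rho>1 \<mu>1 c \<rho>2 \<mu>2"
    and "ifc c P PA True = (hc, P', PA')"
  shows "spec_obs_equiv (fsfvslh hc) \<rho>1 \<mu>1 False (fsfvslh hc) \<rho>2 \<mu>2 False"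
proof -
  have "tr (\<lambda>\<rho>. \<rho>) c P PA (fsfvslh hc) P' PA'"
    using tr_fsfvslh[OF assms(1), of P' P PA True PA'] assms(9) by simp
  moreover have "low_eq False P PA \<rho>1 \<mu>1 \<rho>2 \<mu>2"
    using assms by (simp add: low_eq_def)
  ultimately show ?thesis
    unfolding spec_obs_equiv_def
    by (intro allI impI) (rule tr_steps[where F = "\<lambda>\<rho>. \<rho>", OF _ _ _ _ assms(8)])
qed

end
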